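(* Let $A=(a_{ij})$ be a real $n\times n$ matrix satisfying $$a_{ii} \geq a_{i,i+1} \geq \dots \geq a_{in} \geq a_{i1} \geq \dots \geq a_{i,i-1}, \qquad i=1,\dots,n.$$ Suppose that the directed graph $\mathscr{G}(A)$ has exactly $k$ fundamental closed strongly connected components $C_1,\dots,C_k$ and exactly $\ell$ closed strongly connected components $C_{k+1},\dots,C_{k+\ell}$ that are null, and that for each $i=1,\dots,k$ there is a non-positive or non-negative fundamental solution $x_i\in\mathbb{R}^n$ for $C_i$. Let $\lambda\in\mathbb{R}$ and let $e$ be the vector of all ones. Then the solutions to the system $A^{\top}x=\lambda e$ are precisely the vectors $$x=\sum_{i=1}^{k}\alpha_i x_i+\sum_{i=1}^{\ell}y_{k+i}$$ with $\alpha_1,\dots,\alpha_k\in\mathbb{R}$, $\sum_{i=1}^k\alpha_i=\lambda$, and $y_{k+i}$ a null vector for $C_{k+i}$ for $i=1,\dots,\ell$.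
   Context: The directed graph $\mathscr{G}(A)$ has vertex set $\{1,\dots,n\}$ and a directed edge from $i$ to $j$ if and only if $\kappa_{ij}=1$, where $\kappa_{ij}:=1$ if ($j=1$ and $a_{in}>a_{i1}$) or ($2\leq j\leq n$ and $a_{i,j-1}>a_{ij}$), and $\kappa_{ij}:=0$ otherwise. Two distinct vertices $i,j$ are strongly connected if there are directed paths in $\mathscr{G}(A)$ from $i$ to $j$ and from $j$ to $i$; every vertex is declared strongly connected to itself. The equivalence classes of this relation are the strongly connected components (SCCs). An SCC $C$ is open if there is a directed edge from a vertex in $C$ to a vertex not in $C$, and closed otherwise. For $I,J\subseteq\{1,\dots,n\}$, $[A]_{IJ}$ denotes the submatrix with rows indexed by $I$ and columns indexed by $J$, $[A]^{\top}_{IJ}$ is the transpose of $[A]_{IJ}$, and $[x]_I$ is the subvector of $x$ with components indexed by $I$. Let $C$ be a closed SCC of $\mathscr{G}(A)$ and $C^c:=\{1,\dots,n\}\setminus C$. $C$ is called fundamental if the system $[A]^{\top}_{CC}[x]_C=[e]_C$, $[x]_{C^c}=0$ has a solution $x\in\mathbb{R}^n$, and any such $x$ is called a fundamental solution for $C$; $C$ is called null if this system has no solution. If $C$ is null, a null vector for $C$ is any $y\in\mathbb{R}^n$ with $[y]_C\in\ker [A]^{\top}_{CC}$ and $[y]_{C^c}=0$. Non-positive and non-negative are meant component-wise. The cases $k=0$ or $\ell=0$ are allowed, with empty sums equal to $0$; in particular, if $k=0$ the statement says that $A^{\top}x=\lambda e$ has no solution for $\lambda\neq 0$. *)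

theory Defs
  imports
    "Graph_Theory.Graph_Theory"
    "Jordan_Normal_Form.DL_Submatrix"
    "Jordan_Normal_Form.Matrix_Kernel"
begin

text \<open>Rows, columns and vertices are indexed by \<open>0, \<dots>, n - 1\<close> instead of \<open>1, \<dots>, n\<close>.\<close>

text \<open>Starting on the diagonal and proceeding cyclically to the right, every row is
  non-increasing; the step from \<open>a(i, i - 1)\<close> back to \<open>a(i, i)\<close> is excluded.\<close>
definition cyclically_nonincreasing :: "real mat \<Rightarrow> bool" where
  "cyclically_nonincreasing A \<longleftrightarrow>
     (\<forall>i < dim_row A. \<forall>m. Suc m < dim_col A \<longrightarrow>
        A $$ (i, (i + m) mod dim_col A) \<ge> A $$ (i, (i + Suc m) mod dim_col A))"

definition kappa :: "real mat \<Rightarrow> nat \<Rightarrow> nat \<Rightarrow> nat" where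
  "kappa A i j =
     (if j = 0 \<and> A $$ (i, dim_col A - 1) > A $$ (i, 0) \<or>
         1 \<le> j \<and> j < dim_col A \<and> A $$ (i, j - 1) > A $$ (i, j)
      then 1 else 0)"

definition mat_digraph :: "real mat \<Rightarrow> (nat, nat \<times> nat) pre_digraph" where
  "mat_digraph A =
     \<lparr> verts = {..<dim_row A},
       arcs = {(i, j). i < dim_row A \<and> j < dim_row A \<and> kappa A i j = 1},
       tail = fst, head = snd \<rparr>"

lemma wf_digraph_mat_digraph: "wf_digraph (mat_digraph A)"
  by unfold_locales (auto simp: mat_digraph_def)

text \<open>Strongly connected components are taken as vertex sets
  (\<^const>\<open>pre_digraph.sccs_verts\<close>). These are the equivalence classes of mutual
  reachability; \<^const>\<open>reachable\<close> is reflexive on the vertices.\<close>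
lemma (in wf_digraph) sccs_verts_eq_quotient:
  "sccs_verts = verts G // {(u, v). u \<rightarrow>\<^sup>* v \<and> v \<rightarrow>\<^sup>* u}" (is "_ = _ // ?R")
proof (intro equalityI subsetI)
  fix S assume S: "S \<in> sccs_verts"
  then obtain u where u: "u \<in> S" "u \<in> verts G"
    by (auto simp: in_sccs_verts_conv_reachable dest: reachable_in_verts)
  have "S = ?R `` {u}"
    using S u unfolding in_sccs_verts_conv_reachable by blast
  then show "S \<in> verts G // ?R"
    using u by (auto simp: quotient_def)
next
  fix S assume "S \<in> verts G // ?R"
  then obtain u where u: "u \<in> verts G" and S: "S = ?R `` {u}"
    by (auto simp: quotient_def)
  have "u \<in> S" using u S by auto
  then show "S \<in> sccs_verts"
    unfolding in_sccs_verts_conv_reachable S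
    by (auto intro: reachable_trans)
qed

definition open_scc :: "('v, 'a) pre_digraph \<Rightarrow> 'v set \<Rightarrow> bool" where
  "open_scc G C \<longleftrightarrow> C \<in> pre_digraph.sccs_verts G \<and>
     (\<exists>u \<in> C. \<exists>v \<in> verts G - C. u \<rightarrow>\<^bsub>G\<^esub> v)"

definition closed_scc :: "('v, 'a) pre_digraph \<Rightarrow> 'v set \<Rightarrow> bool" where
  "closed_scc G C \<longleftrightarrow> C \<in> pre_digraph.sccs_verts G \<and> \<not> open_scc G C"

text \<open>The vector analogue of \<^const>\<open>submatrix\<close>, with the same increasing enumeration
  \<^term>\<open>pick I\<close> of the index set.\<close>
definition subvec :: "'a vec \<Rightarrow> nat set \<Rightarrow> 'a vec" where
  "subvec x I = vec (card {i. i < dim_vec x \<and> i \<in> I}) (\<lambda>i. x $ pick I i)"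

definition ones_vec :: "nat \<Rightarrow> real vec" where
  "ones_vec n = vec n (\<lambda>_. 1)"

definition fundamental_solution :: "real mat \<Rightarrow> nat set \<Rightarrow> real vec \<Rightarrow> bool" where
  "fundamental_solution A C x \<longleftrightarrow>
     (let n = dim_row A; C' = {..<n} - C in
      x \<in> carrier_vec n \<and>
      transpose_mat (submatrix A C C) *\<^sub>v subvec x C = subvec (ones_vec n) C \<and>
      subvec x C' = 0\<^sub>v (card C'))"

definition fundamental_scc :: "real mat \<Rightarrow> nat set \<Rightarrow> bool" where
  "fundamental_scc A C \<longleftrightarrow>
     closed_scc (mat_digraph A) C \<and> (\<exists>x. fundamental_solution A C x)"

definition null_scc :: "real mat \<Rightarrow> nat set \<Rightarrow> bool" where
  "null_scc A C \<longleftrightarrow>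
     closed_scc (mat_digraph A) C \<and> \<not> (\<exists>x. fundamental_solution A C x)"

definition null_vector :: "real mat \<Rightarrow> nat set \<Rightarrow> real vec \<Rightarrow> bool" where
  "null_vector A C y \<longleftrightarrow>
     (let n = dim_row A; C' = {..<n} - C in
      y \<in> carrier_vec n \<and>
      subvec y C \<in> mat_kernel (transpose_mat (submatrix A C C)) \<and>
      subvec y C' = 0\<^sub>v (card C'))"

end

theory Submission
  imports Defs
begin

text \<open>The numbers \<open>q(i, j) = a(i, j - 1) - a(i, j)\<close> (column index cyclic) are non-negative off the
  diagonal and have row sums \<open>0\<close>: they are the rates of a continuous-time Markov chain whose
  transition graph is \<open>mat_digraph A\<close>, and \<open>A\<^sup>T z\<close> is a multiple of \<open>e\<close> if and only if \<open>z\<close> is a signed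
  stationary measure. If \<open>z\<close> is stationary, so is \<open>\<bar>z\<bar>\<close>; hence the zero set of \<open>z\<close> is closed under
  predecessors, \<open>z\<close> lives on the closed components, and its restriction to each of them is
  stationary and unique up to a scalar. On a closed component, stationarity of a supported vector
  is already decided by \<open>[A]\<^sub>C\<^sub>C\<close>, because a row with index in
  \<open>C\<close> drops only at columns in \<open>C\<close>.\<close>

section \<open>Closed strongly connected components\<close>

lemma (in wf_digraph) closed_scc_arc:
  assumes "closed_scc G C" "u \<in> C" "u \<rightarrow> v"
  shows "v \<in> C"
  using assms adj_in_verts(2) unfolding closed_scc_def open_scc_def by blast

lemma (in wf_digraph) closed_scc_unique:
  assumes "closed_scc G C" "closed_scc G D" "u \<in> C" "u \<in> D"
  shows "C = D"
  using assms sccs_verts_disjoint unfolding closed_scc_def by blast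

section \<open>Signed stationary measures on a digraph\<close>

text \<open>Arcs say nothing about the diagonal of \<open>q\<close>; the zero row sums determine it,
  as minus the total rate of leaving \<open>u\<close>.\<close>

locale rate_digraph = wf_digraph G for G :: "('a, 'b) pre_digraph" (structure) +
  fixes q :: "'a \<Rightarrow> 'a \<Rightarrow> real"
  assumes finite_verts: "finite (verts G)"
    and rate_nonneg: "\<lbrakk>u \<in> verts G; v \<in> verts G; u \<noteq> v\<rbrakk> \<Longrightarrow> 0 \<le> q u v"
    and rate_pos_iff: "\<lbrakk>u \<in> verts G; v \<in> verts G; u \<noteq> v\<rbrakk> \<Longrightarrow> 0 < q u v \<longleftrightarrow> u \<rightarrow> v"
    and rate_sum: "u \<in> verts G \<Longrightarrow> (\<Sum>v \<in> verts G. q u v) = 0"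
begin

definition stationary :: "('a \<Rightarrow> real) \<Rightarrow> bool" where
  "stationary z \<longleftrightarrow> (\<forall>v \<in> verts G. (\<Sum>u \<in> verts G. z u * q u v) = 0)"

lemma stationary_lincomb:
  assumes "stationary z" "stationary w"
  shows "stationary (\<lambda>u. a * z u + b * w u)"
  using assms unfolding stationary_def
  by (simp add: algebra_simps sum.distrib flip: sum_distrib_left)

lemma rate_diag_nonpos:
  assumes "u \<in> verts G"
  shows "q u u \<le> 0"
proof -
  have "q u u + (\<Sum>v \<in> verts G - {u}. q u v) = 0"
    using rate_sum[OF assms] sum.remove[OF finite_verts assms, of "q u"] by simp
  moreover have "0 \<le> (\<Sum>v \<in> verts G - {u}. q u v)"
    using assms by (intro sum_nonneg) (auto intro: rate_nonneg)
  ultimately show ?thesis by simp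
qed

text \<open>In the balance at \<open>v\<close> only the diagonal rate can be negative. Isolating its
  term and applying the triangle inequality to the others shows that the net flow of \<bar>z\<bar>
  at \<open>v\<close> is at least 0. Summed over all \<open>v\<close>, these flows vanish because
  the row sums do, so each of them is 0.\<close>

lemma stationary_abs:
  assumes "stationary z"
  shows "stationary (\<lambda>u. \<bar>z u\<bar>)"
proof -
  let ?flow = "\<lambda>v. \<Sum>u \<in> verts G. \<bar>z u\<bar> * q u v"
  have nonneg: "0 \<le> ?flow v" if v: "v \<in> verts G" for v
  proof -
    have "(\<Sum>u \<in> verts G. z u * q u v) = 0"
      using assms v by (simp add: stationary_def)
    then have "\<bar>z v * q v v\<bar> = \<bar>\<Sum>u \<in> verts G - {v}. z u * q u v\<bar>"
      using sum.remove[OF finite_verts v, of "\<lambda>u. z u * q u v"] by linarith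
    also have "\<dots> \<le> (\<Sum>u \<in> verts G - {v}. \<bar>z u * q u v\<bar>)"
      by (rule sum_abs)
    also have "\<dots> = (\<Sum>u \<in> verts G - {v}. \<bar>z u\<bar> * q u v)"
      using v by (intro sum.cong) (auto simp: abs_mult rate_nonneg)
    finally show ?thesis
      using sum.remove[OF finite_verts v, of "\<lambda>u. \<bar>z u\<bar> * q u v"] rate_diag_nonpos[OF v]
      by (simp add: abs_mult)
  qed
  have "(\<Sum>v \<in> verts G. ?flow v) = (\<Sum>u \<in> verts G. \<bar>z u\<bar> * (\<Sum>v \<in> verts G. q u v))"
    unfolding sum_distrib_left by (rule sum.swap)
  also have "\<dots> = 0"
    by (simp add: rate_sum)
  finally have "\<forall>v \<in> verts G. ?flow v = 0"
    using sum_nonneg_eq_0_iff[OF finite_verts nonneg] by simp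
  then show ?thesis
    by (simp add: stationary_def)
qed

text \<open>Where \<open>z v = 0\<close>, the diagonal term drops out of the balance of
  \<bar>z\<bar>. What remains is a vanishing sum of non-negative terms, and in the term of
  \<open>u\<close> the rate is positive.\<close>

lemma stationary_zero_pred:
  assumes "stationary z" "u \<rightarrow> v" "z v = 0"
  shows "z u = 0"
proof (cases "u = v")
  case False
  have uv: "u \<in> verts G" "v \<in> verts G"
    using assms(2) adj_in_verts by auto
  have "(\<Sum>w \<in> verts G. \<bar>z w\<bar> * q w v) = 0"
    using stationary_abs[OF assms(1)] uv by (simp add: stationary_def)
  moreover have "0 \<le> \<bar>z w\<bar> * q w v" if "w \<in> verts G" for w
    using that uv rate_nonneg[of w v] assms(3) by (cases "w = v") auto
  ultimately have "\<bar>z u\<bar> * q u v = 0"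
    using uv by (simp add: sum_nonneg_eq_0_iff[OF finite_verts])
  then show ?thesis
    using rate_pos_iff[of u v] uv False assms(2) by simp
qed (use assms in simp)

lemma stationary_zero_reachable:
  assumes "stationary z" "u \<rightarrow>\<^sup>* v" "z v = 0"
  shows "z u = 0"
  using assms(2,3) by induction (auto intro: stationary_zero_pred[OF assms(1)])

text \<open>No mass can flow into a successor-closed set \<open>T\<close>, since none ever flows
  out. Adding the balances of \<bar>z\<bar> over \<open>T\<close> gives 0; vertices of
  \<open>T\<close> contribute nothing, vertices outside contribute non-negative amounts, and
  \<open>u\<close> contributes \<bar>z u\<bar> times a positive rate.\<close>

lemma stationary_zero_leaving:
  assumes "stationary z" and T: "T \<subseteq> verts G" "\<And>t v. \<lbrakk>t \<in> T; t \<rightarrow> v\<rbrakk> \<Longrightarrow> v \<in> T"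
    and "u \<notin> T" "w \<in> T" "u \<rightarrow> w"
  shows "z u = 0"
proof -
  let ?out = "\<lambda>s. \<Sum>t \<in> T. q s t"
  \<comment> \<open>All rates from \<open>s\<close> to vertices outside \<open>T\<close> are 0, so
    the sum over \<open>T\<close>, diagonal included, is the whole row sum.\<close>
  have T_out: "?out s = 0" if s: "s \<in> T" for s
  proof -
    have "(\<Sum>t \<in> verts G - T. q s t) = 0"
    proof (intro sum.neutral ballI)
      fix t assume t: "t \<in> verts G - T"
      then have "\<not> s \<rightarrow> t" "s \<noteq> t" "s \<in> verts G"
        using T s by auto
      then show "q s t = 0"
        using rate_nonneg[of s t] rate_pos_iff[of s t] t by force
    qed
    then show ?thesis
      using rate_sum[of s] sum.subset_diff[OF T(1) finite_verts, of "q s"] T(1) s by auto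
  qed
  have nonneg: "0 \<le> \<bar>z s\<bar> * ?out s" if "s \<in> verts G" for s
  proof (cases "s \<in> T")
    case False
    then have "0 \<le> ?out s"
      using that T(1) by (intro sum_nonneg rate_nonneg) auto
    then show ?thesis by simp
  qed (simp add: T_out)
  have "(\<Sum>s \<in> verts G. \<bar>z s\<bar> * ?out s) = (\<Sum>t \<in> T. \<Sum>s \<in> verts G. \<bar>z s\<bar> * q s t)"
    unfolding sum_distrib_left by (rule sum.swap)
  also have "\<dots> = 0"
    using stationary_abs[OF assms(1)] T(1) by (intro sum.neutral) (auto simp: stationary_def)
  finally have "\<bar>z u\<bar> * ?out u = 0"
    using sum_nonneg_eq_0_iff[OF finite_verts nonneg] adj_in_verts(1)[OF assms(6)] by simp
  moreover have "0 < ?out u"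
  proof (rule sum_pos2[OF finite_subset[OF T(1) finite_verts] assms(5)])
    show "0 < q u w"
      using assms(4-6) rate_pos_iff[of u w] adj_in_verts[OF assms(6)] by auto
  qed (use T(1) assms(4) adj_in_verts(1)[OF assms(6)] in \<open>auto intro!: rate_nonneg\<close>)
  ultimately show ?thesis by simp
qed

text \<open>If an arc from \<open>u\<close> to \<open>w\<close> left the component of
  \<open>v\<close>, take \<open>T\<close> as the set of vertices that cannot reach \<open>v\<close>.
  It is successor-closed and contains \<open>w\<close> but not \<open>u\<close>, so
  \<open>z u = 0\<close>. As \<open>v\<close> reaches \<open>u\<close>, this forces
  \<open>z v = 0\<close>.\<close>

lemma stationary_support:
  assumes "stationary z" "v \<in> verts G" "z v \<noteq> 0"
  obtains C where "closed_scc G C" "v \<in> C"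
proof -
  have scc: "scc_of v \<in> sccs_verts" and v: "v \<in> scc_of v"
    using assms(2) by (auto intro: scc_of_in_sccs_verts in_scc_of_self)
  have "\<not> open_scc G (scc_of v)"
  proof
    assume "open_scc G (scc_of v)"
    then obtain u w where uw: "u \<in> scc_of v" "w \<notin> scc_of v" "u \<rightarrow> w"
      unfolding open_scc_def by blast
    have uv: "u \<rightarrow>\<^sup>* v" "v \<rightarrow>\<^sup>* u"
      using uw(1) by (auto simp: scc_of_def)
    have "v \<rightarrow>\<^sup>* w"
      using uv uw(3) by (meson reachable_adj_trans)
    then have wv: "\<not> w \<rightarrow>\<^sup>* v"
      using uw(2) by (auto simp: scc_of_def)
    have "z u = 0"
    proof (rule stationary_zero_leaving[OF assms(1), of "{t \<in> verts G. \<not> t \<rightarrow>\<^sup>* v}"])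
      show "x \<in> {t \<in> verts G. \<not> t \<rightarrow>\<^sup>* v}" if "t \<in> {t \<in> verts G. \<not> t \<rightarrow>\<^sup>* v}" "t \<rightarrow> x" for t x
        using that adj_in_verts(2) adj_reachable_trans by blast
    qed (use uv uw wv adj_in_verts(2) in auto)
    then show False
      using stationary_zero_reachable[OF assms(1) uv(2)] assms(3) by blast
  qed
  then show thesis
    using that scc v by (auto simp: closed_scc_def)
qed

text \<open>At \<open>v\<close> in \<open>C\<close> nothing is lost: a vertex outside
  \<open>C\<close> that carries mass lies in another closed component and has no arc to
  \<open>v\<close>. At \<open>v\<close> outside \<open>C\<close> every term is 0, because no arc
  leaves \<open>C\<close>.\<close>

lemma stationary_restrict:
  assumes "stationary z" "closed_scc G C"
  shows "stationary (\<lambda>u. if u \<in> C then z u else 0)"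
  unfolding stationary_def
proof
  fix v assume v: "v \<in> verts G"
  have rate0: "q u v = 0" if "u \<in> verts G" "\<not> u \<rightarrow> v" "u \<noteq> v" for u
    using rate_nonneg[of u v] rate_pos_iff[of u v] that v by force
  show "(\<Sum>u \<in> verts G. (if u \<in> C then z u else 0) * q u v) = 0"
  proof (cases "v \<in> C")
    case True
    have "(if u \<in> C then z u else 0) * q u v = z u * q u v" if u: "u \<in> verts G" for u
    proof (cases "u \<in> C \<or> z u = 0")
      case False
      then obtain D where D: "closed_scc G D" "u \<in> D"
        using stationary_support[OF assms(1) u] by blast
      have "\<not> u \<rightarrow> v"
        using closed_scc_arc[OF D] closed_scc_unique[OF D(1) assms(2) _ True] D(2) False by blast
      then show ?thesis
        using rate0[OF u] True False by auto
    qed auto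
    then have "(\<Sum>u \<in> verts G. (if u \<in> C then z u else 0) * q u v) = (\<Sum>u \<in> verts G. z u * q u v)"
      by (intro sum.cong) auto
    then show ?thesis
      using assms(1) v by (simp add: stationary_def)
  next
    case False
    then show ?thesis
      using closed_scc_arc[OF assms(2)] rate0 by (intro sum.neutral) auto
  qed
qed

lemma stationary_eq_zero:
  assumes "stationary z" "closed_scc G C" "\<And>u. \<lbrakk>u \<in> verts G; u \<notin> C\<rbrakk> \<Longrightarrow> z u = 0"
    and "p \<in> C" "z p = 0" "u \<in> verts G"
  shows "z u = 0"
proof (cases "u \<in> C")
  case True
  then have "u \<rightarrow>\<^sup>* p"
    using assms(2,4) by (auto simp: closed_scc_def in_sccs_verts_conv_reachable)
  then show ?thesis
    by (rule stationary_zero_reachable[OF assms(1)]) (rule assms(5))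
qed (use assms in simp)

text \<open>The combination of \<open>z\<close> and \<open>w\<close> that vanishes at
  \<open>p\<close> is stationary and supported on \<open>C\<close>. Every vertex of \<open>C\<close>
  reaches \<open>p\<close>, so the zero at \<open>p\<close> spreads over all of
  \<open>C\<close>.\<close>

lemma stationary_proportional:
  assumes "stationary z" "stationary w" "closed_scc G C"
    and "\<And>u. \<lbrakk>u \<in> verts G; u \<notin> C\<rbrakk> \<Longrightarrow> z u = 0"
    and "\<And>u. \<lbrakk>u \<in> verts G; u \<notin> C\<rbrakk> \<Longrightarrow> w u = 0"
    and "p \<in> verts G" "w p \<noteq> 0" "u \<in> verts G"
  shows "z u = z p / w p * w u"
proof -
  have "1 * z u + (- z p / w p) * w u = 0"
  proof (rule stationary_eq_zero[OF stationary_lincomb[OF assms(1,2)] assms(3)])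
    show "p \<in> C" using assms(5-7) by blast
  qed (use assms(4-8) in auto)
  then show ?thesis by simp
qed

end

section \<open>Subvectors and principal submatrices\<close>

lemma bij_betw_pick:
  assumes "finite I"
  shows "bij_betw (pick I) {..<card I} I"
proof -
  have "inj_on (pick I) {..<card I}"
    by (intro inj_onI) (metis lessThan_iff nat_neq_iff pick_mono_le)
  moreover have "pick I ` {..<card I} = I"
    using assms calculation by (intro card_subset_eq) (auto intro: pick_in_set_le simp: card_image)
  ultimately show ?thesis
    by (simp add: bij_betw_def)
qed

lemma subvec_eq_iff:
  assumes "v \<in> carrier_vec n" "w \<in> carrier_vec n" "I \<subseteq> {..<n}"
  shows "subvec v I = subvec w I \<longleftrightarrow> (\<forall>i \<in> I. v $ i = w $ i)"
proof -
  have I: "{i. i < n \<and> i \<in> I} = I" and fin: "finite I"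
    using assms(3) by (auto intro: finite_subset)
  have "subvec v I = subvec w I \<longleftrightarrow> (\<forall>k \<in> {..<card I}. v $ pick I k = w $ pick I k)"
    using assms(1,2) I by (auto simp: subvec_def vec_eq_iff)
  also have "\<dots> \<longleftrightarrow> (\<forall>i \<in> pick I ` {..<card I}. v $ i = w $ i)"
    by blast
  also have "pick I ` {..<card I} = I"
    using bij_betw_pick[OF fin] by (simp add: bij_betw_def)
  finally show ?thesis .
qed

lemma subvec_zero_vec:
  assumes "I \<subseteq> {..<n}"
  shows "subvec (0\<^sub>v n) I = 0\<^sub>v (card I)"
proof -
  have I: "{i. i < n \<and> i \<in> I} = I" and fin: "finite I"
    using assms by (auto intro: finite_subset)
  have "pick I k < n" if "k < card I" for k
    using pick_in_set_le[OF that] assms by auto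
  then show ?thesis
    using I by (auto simp: subvec_def vec_eq_iff)
qed

text \<open>Rows outside \<open>I\<close> meet zero entries of \<open>v\<close>, so the short sums
  over positions in \<open>I\<close> agree with the full sums over all rows.\<close>

lemma principal_submatrix_mult_subvec:
  fixes A :: "real mat"
  assumes A: "A \<in> carrier_mat n n" and v: "v \<in> carrier_vec n" and I: "I \<subseteq> {..<n}"
    and supp: "\<And>i. i < n \<Longrightarrow> i \<notin> I \<Longrightarrow> v $ i = 0"
  shows "transpose_mat (submatrix A I I) *\<^sub>v subvec v I = subvec (transpose_mat A *\<^sub>v v) I"
proof -
  have I': "{i. i < n \<and> i \<in> I} = I" and fin: "finite I"
    using I by (auto intro: finite_subset)
  have "(\<Sum>k < card I. A $$ (pick I k, j) * v $ pick I k) = (\<Sum>i < n. A $$ (i, j) * v $ i)" for j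
  proof -
    have "(\<Sum>k < card I. A $$ (pick I k, j) * v $ pick I k) = (\<Sum>i \<in> I. A $$ (i, j) * v $ i)"
      by (rule sum.reindex_bij_betw[OF bij_betw_pick[OF fin]])
    also have "\<dots> = (\<Sum>i < n. A $$ (i, j) * v $ i)"
      using I supp by (intro sum.mono_neutral_left) auto
    finally show ?thesis .
  qed
  moreover have "pick I k < n" if "k < card I" for k
    using pick_in_set_le[OF that] I by auto
  ultimately show ?thesis
    using A v I' by (intro eq_vecI)
      (auto simp: subvec_def submatrix_def scalar_prod_def lessThan_atLeast0)
qed

section \<open>The matrix as a rate digraph\<close>

text \<open>The case split supplies the wrap-around, since subtraction on naturals truncates at
  0.\<close>

definition cyc_pred :: "nat \<Rightarrow> nat \<Rightarrow> nat" where
  "cyc_pred n j = (if j = 0 then n - 1 else j - 1)"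

lemma cyc_pred_mod:
  assumes "0 < n"
  shows "cyc_pred n (Suc j mod n) = j mod n"
  using assms by (auto simp: cyc_pred_def mod_Suc)

lemma cyc_pred_less: "j < n \<Longrightarrow> cyc_pred n j < n"
  by (auto simp: cyc_pred_def)

lemma sum_cyc_pred:
  fixes f :: "nat \<Rightarrow> 'a::comm_monoid_add"
  shows "(\<Sum>j<n. f (cyc_pred n j)) = (\<Sum>j<n. f j)"
proof (cases n)
  case (Suc m)
  then show ?thesis
    by (subst Suc, subst sum.lessThan_Suc_shift) (simp add: cyc_pred_def add.commute)
qed simp

text \<open>Walk forward around the cycle from \<open>j\<^sub>0\<close>: an index in
  \<open>C\<close> has the value \<open>c\<close> by assumption, any other index inherits the value
  of its predecessor.\<close>

lemma cyclically_constant: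
  assumes "j\<^sub>0 \<in> C" "C \<subseteq> {..<n}" "\<And>j. j \<in> C \<Longrightarrow> f j = c"
    and step: "\<And>j. \<lbrakk>j < n; j \<notin> C\<rbrakk> \<Longrightarrow> f (cyc_pred n j) = f j"
    and "j < n"
  shows "f j = c"
proof -
  have n: "0 < n" using assms(5) by simp
  have "f ((j\<^sub>0 + m) mod n) = c" for m
  proof (induction m)
    case 0
    have "j\<^sub>0 < n" using assms(1,2) by auto
    then show ?case using assms(1,3) by simp
  next
    case (Suc m)
    let ?j = "Suc (j\<^sub>0 + m) mod n"
    show ?case
    proof (cases "?j \<in> C")
      case False
      then have "f (cyc_pred n ?j) = f ?j"
        using n by (intro step) auto
      then show ?thesis
        using Suc n by (simp add: cyc_pred_mod)
    qed (use assms(3) in simp)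
  qed
  \<comment> \<open>This many steps lead from \<open>j\<^sub>0\<close> to \<open>n + j\<close>,
    which is \<open>j\<close> modulo \<open>n\<close>.\<close>
  from this[of "n - j\<^sub>0 + j"] show ?thesis
    using assms(1,2,5) by (auto simp: subset_iff)
qed

text \<open>These are the rates q(i, j) of the chain, diagonal included.\<close>

definition col_drop :: "real mat \<Rightarrow> nat \<Rightarrow> nat \<Rightarrow> real" where
  "col_drop A i j = A $$ (i, cyc_pred (dim_col A) j) - A $$ (i, j)"

lemma kappa_eq_1_iff: "j < dim_col A \<Longrightarrow> kappa A i j = 1 \<longleftrightarrow> 0 < col_drop A i j"
  by (auto simp: kappa_def col_drop_def cyc_pred_def)

lemma col_drop_nonneg:
  assumes "cyclically_nonincreasing A" "i < dim_row A" "i < dim_col A" "j < dim_col A" "i \<noteq> j"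
  shows "0 \<le> col_drop A i j"
proof -
  let ?n = "dim_col A"
  \<comment> \<open>\<open>Suc m\<close> is the cyclic distance from \<open>i\<close> to
    \<open>j\<close>. As \<open>i\<close> and \<open>j\<close> differ, it is less than
    \<open>n\<close>, which avoids the one step of the row where no monotonicity is assumed.\<close>
  define m where "m = (if i < j then j - i - 1 else ?n + j - i - 1)"
  have m: "Suc m < ?n"
    using assms(3-5) by (auto simp: m_def)
  have "i + Suc m = (if i < j then j else ?n + j)"
    using assms(3-5) by (auto simp: m_def)
  then have j: "(i + Suc m) mod ?n = j"
    using assms(4) by (simp split: if_splits)
  moreover have "(i + m) mod ?n = cyc_pred ?n j"
    using cyc_pred_mod[of ?n "i + m"] m j by simp
  moreover have "A $$ (i, (i + m) mod ?n) \<ge> A $$ (i, (i + Suc m) mod ?n)"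
    using assms(1,2) m unfolding cyclically_nonincreasing_def by blast
  ultimately show ?thesis
    by (simp add: col_drop_def)
qed

lemma adj_mat_digraph:
  "i \<rightarrow>\<^bsub>mat_digraph A\<^esub> j \<longleftrightarrow> i < dim_row A \<and> j < dim_row A \<and> kappa A i j = 1"
  by (auto simp: mat_digraph_def arcs_ends_def arc_to_ends_def image_iff)

lemma verts_mat_digraph: "verts (mat_digraph A) = {..<dim_row A}"
  by (simp add: mat_digraph_def)

lemma rate_digraph_mat_digraph:
  assumes "A \<in> carrier_mat n n" "cyclically_nonincreasing A"
  shows "rate_digraph (mat_digraph A) (col_drop A)"
proof -
  interpret wf_digraph "mat_digraph A"
    by (rule wf_digraph_mat_digraph)
  show ?thesis
  proof unfold_locales
    fix i assume "i \<in> verts (mat_digraph A)"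
    \<comment> \<open>The drops telescope around the cycle.\<close>
    show "(\<Sum>j \<in> verts (mat_digraph A). col_drop A i j) = 0"
      using assms(1) sum_cyc_pred[of "\<lambda>j. A $$ (i, j)" n]
      by (simp add: verts_mat_digraph col_drop_def sum_subtractf)
  qed (use assms in \<open>auto simp: verts_mat_digraph adj_mat_digraph kappa_eq_1_iff col_drop_nonneg
    simp del: One_nat_def\<close>)
qed

section \<open>Solutions of the linear system as stationary measures\<close>

locale cyclic_matrix =
  fixes A :: "real mat" and n :: nat
  assumes n_pos: "0 < n" and A: "A \<in> carrier_mat n n" and noninc: "cyclically_nonincreasing A"
begin

sublocale rate_digraph "mat_digraph A" "col_drop A"
  by (rule rate_digraph_mat_digraph[OF A noninc])

lemma verts_eq [simp]: "verts (mat_digraph A) = {..<n}"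
  using A by (simp add: verts_mat_digraph)

lemma index_transpose_mult:
  assumes "z \<in> carrier_vec n" "j < n"
  shows "(transpose_mat A *\<^sub>v z) $ j = (\<Sum>i<n. A $$ (i, j) * z $ i)"
  using assms A by (simp add: scalar_prod_def lessThan_atLeast0)

lemma closed_scc_verts:
  assumes "closed_scc (mat_digraph A) C"
  shows "C \<subseteq> {..<n}" "C \<noteq> {}"
  using assms sccs_verts_subsets
  by (auto simp: closed_scc_def in_sccs_verts_conv_reachable[of C])

lemma transpose_mult_eq_ones_iff:
  assumes "z \<in> carrier_vec n"
  shows "transpose_mat A *\<^sub>v z = c \<cdot>\<^sub>v ones_vec n \<longleftrightarrow>
    (\<forall>j<n. (\<Sum>i<n. A $$ (i, j) * z $ i) = c)"
  using assms A index_transpose_mult[OF assms] by (auto simp: vec_eq_iff ones_vec_def)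

text \<open>The balance of \<open>z\<close> at column \<open>j\<close> is the difference of the
  components of \<open>transpose_mat A *\<^sub>v z\<close> at the cyclic predecessor of
  \<open>j\<close> and at \<open>j\<close>. All these differences vanish exactly when the components
  agree around the cycle.\<close>

lemma stationary_iff:
  assumes "z \<in> carrier_vec n"
  shows "stationary (($) z) \<longleftrightarrow> (\<exists>c. transpose_mat A *\<^sub>v z = c \<cdot>\<^sub>v ones_vec n)"
proof -
  let ?f = "\<lambda>j. \<Sum>i<n. A $$ (i, j) * z $ i"
  have "stationary (($) z) \<longleftrightarrow> (\<forall>j<n. ?f (cyc_pred n j) = ?f j)"
    using A by (auto simp: stationary_def col_drop_def algebra_simps sum_subtractf)
  also have "\<dots> \<longleftrightarrow> (\<exists>c. \<forall>j<n. ?f j = c)"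
  proof
    assume "\<forall>j<n. ?f (cyc_pred n j) = ?f j"
    then have "?f j = ?f 0" if "j < n" for j
      using that n_pos \<open>\<forall>j<n. ?f (cyc_pred n j) = ?f j\<close>
      by (auto intro!: cyclically_constant[of 0 "{0}" n ?f "?f 0" j])
    then show "\<exists>c. \<forall>j<n. ?f j = c" by blast
  qed (metis cyc_pred_less)
  finally show ?thesis
    by (simp add: transpose_mult_eq_ones_iff[OF assms])
qed

text \<open>At a column outside \<open>C\<close>, rows in \<open>C\<close> have no drop, since no
  arc leaves \<open>C\<close>, and the other rows are multiplied by 0. Hence the value attained on
  \<open>C\<close> is carried on to every column.\<close>

lemma transpose_mult_const_on_closed:
  assumes C: "closed_scc (mat_digraph A) C" and z: "z \<in> carrier_vec n"
    and supp: "\<And>i. \<lbrakk>i < n; i \<notin> C\<rbrakk> \<Longrightarrow> z $ i = 0"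
  shows "transpose_mat A *\<^sub>v z = c \<cdot>\<^sub>v ones_vec n \<longleftrightarrow>
    (\<forall>j \<in> C. (transpose_mat A *\<^sub>v z) $ j = c)"
proof
  assume const: "\<forall>j \<in> C. (transpose_mat A *\<^sub>v z) $ j = c"
  obtain j\<^sub>0 where j0: "j\<^sub>0 \<in> C"
    using closed_scc_verts[OF C] by auto
  have "(\<Sum>i<n. A $$ (i, j) * z $ i) = c" if "j < n" for j
  proof (rule cyclically_constant[OF j0 closed_scc_verts(1)[OF C] _ _ that])
    fix j assume j: "j < n" "j \<notin> C"
    have "A $$ (i, cyc_pred n j) * z $ i = A $$ (i, j) * z $ i" if i: "i < n" for i
    proof (cases "i \<in> C")
      case True
      then have "\<not> i \<rightarrow>\<^bsub>mat_digraph A\<^esub> j" "i \<noteq> j"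
        using closed_scc_arc[OF C] j by auto
      then have "col_drop A i j = 0"
        using rate_nonneg[of i j] rate_pos_iff[of i j] i j by force
      then show ?thesis
        using A by (simp add: col_drop_def)
    qed (simp add: supp i)
    then show "(\<Sum>i<n. A $$ (i, cyc_pred n j) * z $ i) = (\<Sum>i<n. A $$ (i, j) * z $ i)"
      by (intro sum.cong) auto
  qed (use const closed_scc_verts(1)[OF C] in \<open>auto simp flip: index_transpose_mult[OF z]\<close>)
  then show "transpose_mat A *\<^sub>v z = c \<cdot>\<^sub>v ones_vec n"
    by (simp add: transpose_mult_eq_ones_iff[OF z])
next
  assume "transpose_mat A *\<^sub>v z = c \<cdot>\<^sub>v ones_vec n"
  then show "\<forall>j \<in> C. (transpose_mat A *\<^sub>v z) $ j = c"
    using closed_scc_verts(1)[OF C] by (auto simp: ones_vec_def)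
qed

section \<open>Solutions supported on one closed component\<close>

definition supported :: "real vec \<Rightarrow> nat set \<Rightarrow> bool" where
  "supported z C \<longleftrightarrow> z \<in> carrier_vec n \<and> (\<forall>i<n. i \<notin> C \<longrightarrow> z $ i = 0)"

lemma supported_iff:
  "supported z C \<longleftrightarrow> z \<in> carrier_vec n \<and> subvec z ({..<n} - C) = 0\<^sub>v (card ({..<n} - C))"
  using subvec_eq_iff[of z n "0\<^sub>v n" "{..<n} - C"]
  by (auto simp: supported_def subvec_zero_vec)

text \<open>The subsystem on \<open>C\<close> states the equations of the full system at the columns
  in \<open>C\<close>; on a closed component these imply the remaining ones.\<close>

lemma fundamental_solution_iff:
  assumes C: "closed_scc (mat_digraph A) C"
  shows "fundamental_solution A C x \<longleftrightarrow>
    supported x C \<and> transpose_mat A *\<^sub>v x = ones_vec n"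
proof (cases "supported x C")
  case True
  then have x: "x \<in> carrier_vec n" and supp: "\<And>i. \<lbrakk>i < n; i \<notin> C\<rbrakk> \<Longrightarrow> x $ i = 0"
    by (auto simp: supported_def)
  have Ax: "transpose_mat A *\<^sub>v x \<in> carrier_vec n"
    using A x by simp
  have "fundamental_solution A C x \<longleftrightarrow>
      subvec (transpose_mat A *\<^sub>v x) C = subvec (ones_vec n) C"
    using True A principal_submatrix_mult_subvec[OF A x closed_scc_verts(1)[OF C] supp]
    by (auto simp: fundamental_solution_def Let_def supported_iff)
  also have "\<dots> \<longleftrightarrow> (\<forall>j \<in> C. (transpose_mat A *\<^sub>v x) $ j = 1)"
    using closed_scc_verts(1)[OF C] subvec_eq_iff[OF Ax _ closed_scc_verts(1)[OF C]]
    by (auto simp: ones_vec_def subset_iff)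
  also have "\<dots> \<longleftrightarrow> transpose_mat A *\<^sub>v x = ones_vec n"
    using transpose_mult_const_on_closed[OF C x supp, of 1] by simp
  finally show ?thesis
    using True by simp
qed (use A in \<open>auto simp: fundamental_solution_def Let_def supported_iff\<close>)

text \<open>The same passage from \<open>C\<close> to all columns, with constant 0 in place of
  1.\<close>

lemma null_vector_iff:
  assumes C: "closed_scc (mat_digraph A) C"
  shows "null_vector A C y \<longleftrightarrow> supported y C \<and> transpose_mat A *\<^sub>v y = 0\<^sub>v n"
proof (cases "supported y C")
  case True
  then have y: "y \<in> carrier_vec n" and supp: "\<And>i. \<lbrakk>i < n; i \<notin> C\<rbrakk> \<Longrightarrow> y $ i = 0"
    by (auto simp: supported_def)
  have Ay: "transpose_mat A *\<^sub>v y \<in> carrier_vec n"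
    using A y by simp
  have "{i. i < n \<and> i \<in> C} = C"
    using closed_scc_verts(1)[OF C] by auto
  then have "subvec y C \<in> carrier_vec (card C)" "dim_row (submatrix A C C) = card C"
      "dim_col (submatrix A C C) = card C"
    using A y by (auto simp: subvec_def dim_submatrix)
  then have "null_vector A C y \<longleftrightarrow>
      subvec (transpose_mat A *\<^sub>v y) C = subvec (0\<^sub>v n) C"
    using True A principal_submatrix_mult_subvec[OF A y closed_scc_verts(1)[OF C] supp]
    by (auto simp: null_vector_def Let_def supported_iff mat_kernel_def
        subvec_zero_vec[OF closed_scc_verts(1)[OF C]])
  also have "\<dots> \<longleftrightarrow> (\<forall>j \<in> C. (transpose_mat A *\<^sub>v y) $ j = 0)"
    using closed_scc_verts(1)[OF C] subvec_eq_iff[OF Ay _ closed_scc_verts(1)[OF C]]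
    by (auto simp: subset_iff)
  also have "\<dots> \<longleftrightarrow> transpose_mat A *\<^sub>v y = 0\<^sub>v n"
  proof -
    have "0 \<cdot>\<^sub>v ones_vec n = 0\<^sub>v n"
      by (auto simp: ones_vec_def)
    then show ?thesis
      using transpose_mult_const_on_closed[OF C y supp, of 0] by simp
  qed
  finally show ?thesis
    using True by simp
qed (use A in \<open>auto simp: null_vector_def Let_def supported_iff\<close>)

text \<open>Both vectors are stationary and supported on \<open>C\<close>, hence proportional;
  component 0 of the two systems identifies the factor as \<open>b\<close>.\<close>

lemma fundamental_solution_multiple:
  assumes C: "closed_scc (mat_digraph A) C" and x: "fundamental_solution A C x"
    and v: "supported v C" "transpose_mat A *\<^sub>v v = b \<cdot>\<^sub>v ones_vec n"
  shows "v = b \<cdot>\<^sub>v x"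
proof -
  have x': "supported x C" "transpose_mat A *\<^sub>v x = 1 \<cdot>\<^sub>v ones_vec n"
    using x fundamental_solution_iff[OF C] by auto
  have carrier: "x \<in> carrier_vec n" "v \<in> carrier_vec n"
    using x' v by (auto simp: supported_def)
  have stat: "stationary (($) x)" "stationary (($) v)"
    using carrier x' v by (metis stationary_iff)+
  have "(\<Sum>i<n. A $$ (i, 0) * x $ i) = 1"
    using x'(2) n_pos unfolding transpose_mult_eq_ones_iff[OF carrier(1)] by blast
  \<comment> \<open>A zero vector could not produce the value 1, so \<open>x\<close> has a non-zero
    entry to normalise by.\<close>
  then obtain p where p: "p < n" "x $ p \<noteq> 0"
    by (metis (no_types, lifting) lessThan_iff mult_zero_right sum.neutral zero_neq_one)
  define r where "r = v $ p / x $ p"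
  have r: "v $ i = r * x $ i" if "i < n" for i
    unfolding r_def
    by (rule stationary_proportional[OF stat(2,1) C])
      (use v x' p that in \<open>auto simp: supported_def\<close>)
  have "b = (\<Sum>i<n. A $$ (i, 0) * v $ i)"
    using v(2) n_pos by (simp add: transpose_mult_eq_ones_iff[OF carrier(2)])
  also have "\<dots> = r * (\<Sum>i<n. A $$ (i, 0) * x $ i)"
    by (simp add: r sum_distrib_left mult_ac)
  also have "\<dots> = r"
    using \<open>(\<Sum>i<n. A $$ (i, 0) * x $ i) = 1\<close> by simp
  finally show ?thesis
    using r carrier by (intro eq_vecI) auto
qed

text \<open>Otherwise dividing \<open>v\<close> by \<open>b\<close> would give a fundamental
  solution.\<close>

lemma null_scc_factor_zero:
  assumes C: "null_scc A C" and v: "supported v C" "transpose_mat A *\<^sub>v v = b \<cdot>\<^sub>v ones_vec n"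
  shows "b = 0"
proof (rule ccontr)
  assume "b \<noteq> 0"
  have closed: "closed_scc (mat_digraph A) C"
    using C by (simp add: null_scc_def)
  have "transpose_mat A *\<^sub>v ((1 / b) \<cdot>\<^sub>v v) = (1 / b) \<cdot>\<^sub>v (b \<cdot>\<^sub>v ones_vec n)"
    using A v by (simp add: supported_def mult_mat_vec)
  also have "\<dots> = ones_vec n"
    using \<open>b \<noteq> 0\<close> by (simp add: smult_smult_assoc)
  finally have "fundamental_solution A C ((1 / b) \<cdot>\<^sub>v v)"
    using v(1) by (auto simp: fundamental_solution_iff[OF closed] supported_def)
  then show False
    using C by (auto simp: null_scc_def)
qed

section \<open>Splitting a solution over the closed components\<close>

definition restriction :: "real vec \<Rightarrow> nat set \<Rightarrow> real vec" where
  "restriction z C = vec n (\<lambda>i. if i \<in> C then z $ i else 0)"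

lemma supported_restriction: "supported (restriction z C) C"
  by (simp add: supported_def restriction_def)

text \<open>The constant \<open>b\<close> depends on the component and need not be \<open>c\<close>;
  only the sum of these constants is tied to \<open>c\<close>.\<close>

lemma restriction_const:
  assumes "closed_scc (mat_digraph A) C" "z \<in> carrier_vec n"
    and "transpose_mat A *\<^sub>v z = c \<cdot>\<^sub>v ones_vec n"
  obtains b where "transpose_mat A *\<^sub>v restriction z C = b \<cdot>\<^sub>v ones_vec n"
proof -
  have "stationary (\<lambda>u. if u \<in> C then z $ u else 0)"
    using assms by (intro stationary_restrict) (auto simp: stationary_iff)
  then have "stationary (($) (restriction z C))"
    by (simp add: stationary_def restriction_def)
  then show thesis
    using that supported_restriction[of z C] by (auto simp: stationary_iff supported_def)
qed

text \<open>Closed components are disjoint and cover the support of \<open>z\<close>, so at an index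
  with \<open>z $ j\<close> non-zero exactly one summand survives.\<close>

lemma sum_restriction:
  assumes z: "z \<in> carrier_vec n" "transpose_mat A *\<^sub>v z = c \<cdot>\<^sub>v ones_vec n"
    and C: "bij_betw C T {S. closed_scc (mat_digraph A) S}" and "finite T" and j: "j < n"
  shows "(\<Sum>t \<in> T. restriction z (C t) $ j) = z $ j"
proof (cases "z $ j = 0")
  case True
  then show ?thesis
    using j by (intro trans[OF sum.neutral]) (auto simp: restriction_def)
next
  case False
  have "stationary (($) z)"
    using z by (auto simp: stationary_iff)
  then obtain S where S: "closed_scc (mat_digraph A) S" "j \<in> S"
    using stationary_support[of "($) z" j] j False by auto
  then obtain s where s: "s \<in> T" "C s = S"
    using C unfolding bij_betw_def by (metis imageE mem_Collect_eq)
  have "j \<in> C t \<longleftrightarrow> t = s" if t: "t \<in> T" for t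
  proof
    assume "j \<in> C t"
    moreover have "closed_scc (mat_digraph A) (C t)"
      using C t by (auto simp: bij_betw_def)
    ultimately have "C t = C s"
      using closed_scc_unique[of "C t" S j] S s by blast
    then show "t = s"
      using C t s(1) by (meson bij_betw_imp_inj_on inj_onD)
  qed (use s S in simp)
  then have "(\<Sum>t \<in> T. restriction z (C t) $ j) = (\<Sum>t \<in> T. if t = s then z $ j else 0)"
    using j by (intro sum.cong) (auto simp: restriction_def)
  then show ?thesis
    using s(1) \<open>finite T\<close> by simp
qed

lemma transpose_mult_sum:
  assumes "z \<in> carrier_vec n" "\<And>t. t \<in> T \<Longrightarrow> w t \<in> carrier_vec n"
    and "\<And>i. i < n \<Longrightarrow> z $ i = (\<Sum>t \<in> T. w t $ i)" and "j < n"
  shows "(transpose_mat A *\<^sub>v z) $ j = (\<Sum>t \<in> T. (transpose_mat A *\<^sub>v w t) $ j)"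
proof -
  have "(transpose_mat A *\<^sub>v z) $ j = (\<Sum>i<n. \<Sum>t \<in> T. A $$ (i, j) * w t $ i)"
    using assms by (simp add: index_transpose_mult sum_distrib_left)
  also have "\<dots> = (\<Sum>t \<in> T. \<Sum>i<n. A $$ (i, j) * w t $ i)"
    by (rule sum.swap)
  finally show ?thesis
    using assms by (simp add: index_transpose_mult)
qed

end

lemma sum_atLeast1_add:
  fixes f :: "nat \<Rightarrow> 'a::comm_monoid_add"
  shows "(\<Sum>i = 1..k + l. f i) = (\<Sum>i = 1..k. f i) + (\<Sum>i = 1..l. f (k + i))"
  by (induction l) (simp_all add: add.assoc)

section \<open>Assembling the solution set from the closed components\<close>

theorem theorem5:
  fixes A :: "real mat" and n k l :: nat
    and C :: "nat \<Rightarrow> nat set" and x :: "nat \<Rightarrow> real vec" and lam :: real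
  assumes "n \<ge> 1" and "A \<in> carrier_mat n n"
    and "cyclically_nonincreasing A"
    and "bij_betw C {1..k} {S. fundamental_scc A S}"
    and "bij_betw C {k+1..k+l} {S. null_scc A S}"
    and "\<And>i. i \<in> {1..k} \<Longrightarrow> fundamental_solution A (C i) (x i)"
    and "\<And>i. i \<in> {1..k} \<Longrightarrow> x i \<le> 0\<^sub>v n \<or> 0\<^sub>v n \<le> x i"
  shows "{z \<in> carrier_vec n. transpose_mat A *\<^sub>v z = lam \<cdot>\<^sub>v ones_vec n} =
    {finsum_vec TYPE(real) n (\<lambda>i. \<alpha> i \<cdot>\<^sub>v x i) {1..k} +
     finsum_vec TYPE(real) n (\<lambda>i. y (k + i)) {1..l} | \<alpha> y.
       (\<Sum>i = 1..k. \<alpha> i) = lam \<and>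
       (\<forall>i \<in> {1..l}. null_vector A (C (k + i)) (y (k + i)))}"
proof -
  interpret cyclic_matrix A n
    using assms by unfold_locales auto
  let ?sum = "\<lambda>\<alpha> y. finsum_vec TYPE(real) n (\<lambda>i. \<alpha> i \<cdot>\<^sub>v x i) {1..k} +
    finsum_vec TYPE(real) n (\<lambda>i. y (k + i)) {1..l}"
  have fund: "fundamental_scc A (C i)" if "i \<in> {1..k}" for i
    using assms(4) that by (auto simp: bij_betw_def)
  have null: "null_scc A (C (k + i))" if "i \<in> {1..l}" for i
    using assms(5) that by (auto simp: bij_betw_def)
  have closed: "closed_scc (mat_digraph A) (C i)" if "i \<in> {1..k}" for i
    using fund[OF that] by (simp add: fundamental_scc_def)
  have closed': "closed_scc (mat_digraph A) (C (k + i))" if "i \<in> {1..l}" for i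
    using null[OF that] by (simp add: null_scc_def)
  \<comment> \<open>A closed component is either fundamental or null and never both, so the two
    enumerations join into one of all closed components.\<close>
  have "bij_betw C ({1..k} \<union> {k+1..k+l}) ({S. fundamental_scc A S} \<union> {S. null_scc A S})"
    by (rule bij_betw_combine[OF assms(4,5)]) (auto simp: fundamental_scc_def null_scc_def)
  moreover have "{1..k} \<union> {k+1..k+l} = {1..k+l}" by auto
  moreover have "{S. fundamental_scc A S} \<union> {S. null_scc A S} = {S. closed_scc (mat_digraph A) S}"
    by (auto simp: fundamental_scc_def null_scc_def)
  ultimately have bij: "bij_betw C {1..k+l} {S. closed_scc (mat_digraph A) S}" by simp
  have x: "x i \<in> carrier_vec n" "transpose_mat A *\<^sub>v x i = ones_vec n" if "i \<in> {1..k}" for i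
    using assms(6)[OF that] fundamental_solution_iff[OF closed[OF that]]
    by (auto simp: supported_def)
  have null_vec: "y (k + i) \<in> carrier_vec n" "transpose_mat A *\<^sub>v y (k + i) = 0\<^sub>v n"
    if "\<forall>i \<in> {1..l}. null_vector A (C (k + i)) (y (k + i))" "i \<in> {1..l}" for y i
    using that null_vector_iff[OF closed'] by (auto simp: supported_def)
  have sum_carrier: "?sum \<alpha> y \<in> carrier_vec n"
    if "\<forall>i \<in> {1..l}. null_vector A (C (k + i)) (y (k + i))" for \<alpha> :: "nat \<Rightarrow> real" and y
    using x null_vec[OF that] by (intro add_carrier_vec finsum_vec_closed) auto
  \<comment> \<open>Null indices start at \<open>k + 1\<close>, so the test \<open>t \<le> k\<close>
    merges both families into one real sum.\<close>
  have sum_index: "?sum \<alpha> y $ j =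
      (\<Sum>t = 1..k+l. (if t \<le> k then \<alpha> t \<cdot>\<^sub>v x t else y t) $ j)"
    if y: "\<forall>i \<in> {1..l}. null_vector A (C (k + i)) (y (k + i))" and j: "j < n"
    for \<alpha> :: "nat \<Rightarrow> real" and y j
  proof -
    have "finsum_vec TYPE(real) n (\<lambda>i. y (k + i)) {1..l} \<in> carrier_vec n"
      using null_vec[OF y] by (intro finsum_vec_closed) auto
    moreover have "finsum_vec TYPE(real) n (\<lambda>i. \<alpha> i \<cdot>\<^sub>v x i) {1..k} $ j =
        (\<Sum>i = 1..k. (\<alpha> i \<cdot>\<^sub>v x i) $ j)"
      using x j by (intro index_finsum_vec) auto
    moreover have "finsum_vec TYPE(real) n (\<lambda>i. y (k + i)) {1..l} $ j = (\<Sum>i = 1..l. y (k + i) $ j)"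
      using null_vec[OF y] j by (intro index_finsum_vec) auto
    ultimately show ?thesis
      using j by (simp add: sum_atLeast1_add del: One_nat_def)
  qed
  show ?thesis
  proof (intro equalityI subsetI)
    fix z assume "z \<in> {z \<in> carrier_vec n. transpose_mat A *\<^sub>v z = lam \<cdot>\<^sub>v ones_vec n}"
    then have z: "z \<in> carrier_vec n" "transpose_mat A *\<^sub>v z = lam \<cdot>\<^sub>v ones_vec n"
      by auto
    define u where "u t = restriction z (C t)" for t
    have u: "supported (u t) (C t)" for t
      by (simp add: u_def supported_restriction)
    have "\<exists>b. transpose_mat A *\<^sub>v u t = b \<cdot>\<^sub>v ones_vec n" if "t \<in> {1..k+l}" for t
    proof -
      have "closed_scc (mat_digraph A) (C t)"
        using bij that by (auto simp: bij_betw_def)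
      then show ?thesis
        unfolding u_def by (rule restriction_const[OF _ z]) blast
    qed
    \<comment> \<open>The constants of the pieces serve as the coefficients \<alpha> on the
      fundamental components and vanish on the null ones.\<close>
    then obtain \<beta> where \<beta>: "\<And>t. t \<in> {1..k+l} \<Longrightarrow> transpose_mat A *\<^sub>v u t = \<beta> t \<cdot>\<^sub>v ones_vec n"
      by metis
    have u_fund: "u i = \<beta> i \<cdot>\<^sub>v x i" if "i \<in> {1..k}" for i
      using that by (intro fundamental_solution_multiple[OF closed assms(6)] u \<beta>) auto
    have \<beta>_null: "\<beta> (k + i) = 0" if "i \<in> {1..l}" for i
      using that by (intro null_scc_factor_zero[OF null u \<beta>]) auto
    have u_null: "\<forall>i \<in> {1..l}. null_vector A (C (k + i)) (u (k + i))"
    proof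
      fix i assume i: "i \<in> {1..l}"
      then have "transpose_mat A *\<^sub>v u (k + i) = 0\<^sub>v n"
        using \<beta>[of "k + i"] \<beta>_null[OF i] by (auto simp: ones_vec_def)
      then show "null_vector A (C (k + i)) (u (k + i))"
        using u null_vector_iff[OF closed'[OF i]] by blast
    qed
    have sum_u: "(\<Sum>t = 1..k+l. u t $ j) = z $ j" if "j < n" for j
      unfolding u_def by (rule sum_restriction[OF z bij _ that]) simp
    \<comment> \<open>One component suffices to compare the constants; for \<open>k = 0\<close> this
      yields \<open>lam = 0\<close>.\<close>
    have "lam = (transpose_mat A *\<^sub>v z) $ 0"
      using z n_pos by (simp add: ones_vec_def)
    also have "\<dots> = (\<Sum>t = 1..k+l. (transpose_mat A *\<^sub>v u t) $ 0)"
      using u sum_u n_pos by (intro transpose_mult_sum z(1)) (auto simp: supported_def)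
    also have "\<dots> = (\<Sum>t = 1..k+l. \<beta> t)"
      using \<beta> n_pos by (intro sum.cong) (auto simp: ones_vec_def)
    also have "\<dots> = (\<Sum>i = 1..k. \<beta> i)"
      by (simp add: sum_atLeast1_add \<beta>_null del: One_nat_def)
    finally have lam: "(\<Sum>i = 1..k. \<beta> i) = lam" by simp
    have "z = ?sum \<beta> u"
    proof (rule eq_vecI)
      fix j assume "j < dim_vec (?sum \<beta> u)"
      then have j: "j < n"
        using sum_carrier[OF u_null] by (metis carrier_vecD)
      have "?sum \<beta> u $ j = (\<Sum>t = 1..k+l. u t $ j)"
        unfolding sum_index[OF u_null j] using u_fund by (intro sum.cong) auto
      then show "z $ j = ?sum \<beta> u $ j"
        using sum_u[OF j] by simp
    next
      show "dim_vec z = dim_vec (?sum \<beta> u)"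
        using z(1) sum_carrier[OF u_null] by (metis carrier_vecD)
    qed
    then show "z \<in> {?sum \<alpha> y | \<alpha> y. (\<Sum>i = 1..k. \<alpha> i) = lam \<and>
        (\<forall>i \<in> {1..l}. null_vector A (C (k + i)) (y (k + i)))}"
      using lam u_null by blast
  next
    fix z assume "z \<in> {?sum \<alpha> y | \<alpha> y. (\<Sum>i = 1..k. \<alpha> i) = lam \<and>
        (\<forall>i \<in> {1..l}. null_vector A (C (k + i)) (y (k + i)))}"
    then obtain \<alpha> y where z: "z = ?sum \<alpha> y" and lam: "(\<Sum>i = 1..k. \<alpha> i) = lam"
      and y: "\<forall>i \<in> {1..l}. null_vector A (C (k + i)) (y (k + i))"
      by blast
    define w where "w t = (if t \<le> k then \<alpha> t \<cdot>\<^sub>v x t else y t)" for t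
    have w_fund: "w i \<in> carrier_vec n" "transpose_mat A *\<^sub>v w i = \<alpha> i \<cdot>\<^sub>v ones_vec n"
      if "i \<in> {1..k}" for i
      using that x[OF that] A by (auto simp: w_def mult_mat_vec)
    have w_null: "w (k + i) \<in> carrier_vec n" "transpose_mat A *\<^sub>v w (k + i) = 0\<^sub>v n"
      if "i \<in> {1..l}" for i
      using that null_vec[OF y that] by (auto simp: w_def)
    have w: "w t \<in> carrier_vec n" if "t \<in> {1..k+l}" for t
      using w_fund(1)[of t] w_null(1)[of "t - k"] that by (cases "t \<le> k") (auto simp: le_diff_conv2)
    have z_carrier: "z \<in> carrier_vec n"
      unfolding z by (rule sum_carrier[OF y])
    have "(transpose_mat A *\<^sub>v z) $ j = lam" if j: "j < n" for j
    proof -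
      have "(transpose_mat A *\<^sub>v z) $ j = (\<Sum>t = 1..k+l. (transpose_mat A *\<^sub>v w t) $ j)"
        using w by (intro transpose_mult_sum z_carrier j) (simp_all only: z sum_index[OF y] w_def)
      also have "\<dots> = (\<Sum>i = 1..k. \<alpha> i)"
        using j by (simp add: sum_atLeast1_add w_fund w_null ones_vec_def del: One_nat_def)
      finally show ?thesis
        using lam by simp
    qed
    then have "transpose_mat A *\<^sub>v z = lam \<cdot>\<^sub>v ones_vec n"
      using A by (intro eq_vecI) (auto simp: ones_vec_def)
    then show "z \<in> {z \<in> carrier_vec n. transpose_mat A *\<^sub>v z = lam \<cdot>\<^sub>v ones_vec n}"
      using z_carrier by simp
  qed
qed

end
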